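(* Let $A$ and $C$ be two $B_1$-algebras and $\varphi: A\to C$ a morphism. Then $\tilde\varphi: Spec(C)\to Spec(A)$ maps $MaxSpec(C)$ into $MaxSpec(A)$, and the diagram with top row $\varphi^{-1}: Pr_s(C)\to Pr_s(A)$ ($\mathcal P\mapsto\varphi^{-1}(\mathcal P)$), bottom row $\tilde\varphi: MaxSpec(C)\to MaxSpec(A)$, and vertical maps $\alpha_C: Pr_s(C)\to MaxSpec(C)$ and $\alpha_A: Pr_s(A)\to MaxSpec(A)$, commutes; that is, $\tilde\varphi\circ\alpha_C=\alpha_A\circ\varphi^{-1}$ on $Pr_s(C)$.
   Context: A (commutative) $B_1$-algebra is a commutative semiring $A$ with $0$ (absorbing for multiplication) and $1$, in which $1+1=1$ (so $x+x=x$ for all $x\in A$). Morphisms are semiring homomorphisms preserving $0$ and $1$. An ideal of $A$ is a subset containing $0$, stable under addition and under multiplication by elements of $A$. An ideal $\mathcal P$ is prime if $\mathcal P\neq A$ and $ab\in\mathcal P$ implies $a\in\mathcal P$ or $b\in\mathcal P$. A congruence on $A$ is an equivalence relation compatible with addition and multiplication; the trivial congruence is the one under which any two elements are equivalent. Congruences are ordered by inclusion. For a congruence $\mathcal R$, $I(\mathcal R):=\{x\in A\mid x\,\mathcal R\,0\}$, an ideal. An ideal $J$ is saturated if $J=I(\mathcal R)$ for some congruence $\mathcal R$. A nontrivial congruence $\mathcal R$ is prime if $ab\,\mathcal R\,0$ implies $a\,\mathcal R\,0$ or $b\,\mathcal R\,0$. $Spec(A)$ is the set of prime congruences; $MaxSpec(A)\subseteq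 Spec(A)$ is the set of maximal elements among nontrivial congruences; $Pr_s(A)$ is the set of saturated prime ideals. For $\mathcal P\in Pr_s(A)$, $\alpha_A(\mathcal P):=\mathcal S_{\mathcal P}\in MaxSpec(A)$ is the congruence defined by: $x\,\mathcal S_{\mathcal P}\,y$ if and only if $x,y$ are both in $\mathcal P$ or both not in $\mathcal P$. For a morphism $\varphi:A\to C$ and $\mathcal R\in Spec(C)$, $\tilde\varphi(\mathcal R)\in Spec(A)$ is the congruence on $A$ defined by: $a\,\tilde\varphi(\mathcal R)\,a'$ if and only if $\varphi(a)\,\mathcal R\,\varphi(a')$. *)

theory Defs
  imports "HOL-Algebra.Ring"
begin

locale B1_algebra = semiring A + comm_monoid A for A (structure) +
  assumes one_add_one: "\<one> \<oplus> \<one> = \<one>"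

text \<open>The set \<open>ring_hom\<close> does not require preservation of zero, which is not automatic for semirings.\<close>

definition B1_hom :: "('a, 'm) ring_scheme \<Rightarrow> ('c, 'n) ring_scheme \<Rightarrow> ('a \<Rightarrow> 'c) set" where
  "B1_hom A C = {\<phi> \<in> ring_hom A C. \<phi> \<zero>\<^bsub>A\<^esub> = \<zero>\<^bsub>C\<^esub>}"

text \<open>The library's \<open>ideal\<close> and \<open>primeideal\<close> presuppose additive inverses, hence the following
  versions for semirings.\<close>

definition B1_ideal :: "('a, 'm) ring_scheme \<Rightarrow> 'a set \<Rightarrow> bool" where
  "B1_ideal A J \<longleftrightarrow> J \<subseteq> carrier A \<and> \<zero>\<^bsub>A\<^esub> \<in> J
     \<and> (\<forall>x\<in>J. \<forall>y\<in>J. x \<oplus>\<^bsub>A\<^esub> y \<in> J)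
     \<and> (\<forall>a\<in>carrier A. \<forall>x\<in>J. a \<otimes>\<^bsub>A\<^esub> x \<in> J)"

definition B1_prime_ideal :: "('a, 'm) ring_scheme \<Rightarrow> 'a set \<Rightarrow> bool" where
  "B1_prime_ideal A P \<longleftrightarrow> B1_ideal A P \<and> P \<noteq> carrier A
     \<and> (\<forall>a\<in>carrier A. \<forall>b\<in>carrier A. a \<otimes>\<^bsub>A\<^esub> b \<in> P \<longrightarrow> a \<in> P \<or> b \<in> P)"

definition B1_congruence :: "('a, 'm) ring_scheme \<Rightarrow> 'a rel \<Rightarrow> bool" where
  "B1_congruence A R \<longleftrightarrow> equiv (carrier A) R
     \<and> (\<forall>x x' y y'. (x, x') \<in> R \<longrightarrow> (y, y') \<in> R \<longrightarrow> (x \<oplus>\<^bsub>A\<^esub> y, x' \<oplus>\<^bsub>A\<^esub> y') \<in> R)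
     \<and> (\<forall>x x' y y'. (x, x') \<in> R \<longrightarrow> (y, y') \<in> R \<longrightarrow> (x \<otimes>\<^bsub>A\<^esub> y, x' \<otimes>\<^bsub>A\<^esub> y') \<in> R)"

definition trivial_congruence :: "('a, 'm) ring_scheme \<Rightarrow> 'a rel" where
  "trivial_congruence A = carrier A \<times> carrier A"

definition nontrivial_congruences :: "('a, 'm) ring_scheme \<Rightarrow> 'a rel set" where
  "nontrivial_congruences A = {R. B1_congruence A R \<and> R \<noteq> trivial_congruence A}"

definition zero_class :: "('a, 'm) ring_scheme \<Rightarrow> 'a rel \<Rightarrow> 'a set" where
  "zero_class A R = {x \<in> carrier A. (x, \<zero>\<^bsub>A\<^esub>) \<in> R}"

definition saturated_ideal :: "('a, 'm) ring_scheme \<Rightarrow> 'a set \<Rightarrow> bool" where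
  "saturated_ideal A J \<longleftrightarrow> B1_ideal A J \<and> (\<exists>R. B1_congruence A R \<and> J = zero_class A R)"

definition Spec :: "('a, 'm) ring_scheme \<Rightarrow> 'a rel set" where
  "Spec A = {R \<in> nontrivial_congruences A. \<forall>a\<in>carrier A. \<forall>b\<in>carrier A.
     (a \<otimes>\<^bsub>A\<^esub> b, \<zero>\<^bsub>A\<^esub>) \<in> R \<longrightarrow> (a, \<zero>\<^bsub>A\<^esub>) \<in> R \<or> (b, \<zero>\<^bsub>A\<^esub>) \<in> R}"

definition MaxSpec :: "('a, 'm) ring_scheme \<Rightarrow> 'a rel set" where
  "MaxSpec A = {R \<in> nontrivial_congruences A. \<forall>S\<in>nontrivial_congruences A. R \<subseteq> S \<longrightarrow> S = R}"

definition Pr_s :: "('a, 'm) ring_scheme \<Rightarrow> 'a set set" where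
  "Pr_s A = {P. B1_prime_ideal A P \<and> saturated_ideal A P}"

definition \<alpha> :: "('a, 'm) ring_scheme \<Rightarrow> 'a set \<Rightarrow> 'a rel" where
  "\<alpha> A P = {(x, y) \<in> carrier A \<times> carrier A. (x \<in> P \<and> y \<in> P) \<or> (x \<notin> P \<and> y \<notin> P)}"

definition pullback_congruence :: "('a, 'm) ring_scheme \<Rightarrow> ('a \<Rightarrow> 'c) \<Rightarrow> 'c rel \<Rightarrow> 'a rel" where
  "pullback_congruence A \<phi> R = {(a, a') \<in> carrier A \<times> carrier A. (\<phi> a, \<phi> a') \<in> R}"

definition preimage_ideal :: "('a, 'm) ring_scheme \<Rightarrow> ('a \<Rightarrow> 'c) \<Rightarrow> 'c set \<Rightarrow> 'a set" where
  "preimage_ideal A \<phi> P = {a \<in> carrier A. \<phi> a \<in> P}"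

text \<open>Primality is not part of the definition of \<^const>\<open>MaxSpec\<close>; it follows from maximality:
  if \<open>ab\<close> is congruent to 0 but \<open>a\<close> is not, then identifying \<open>x\<close> and \<open>y\<close> whenever \<open>ax\<close> and \<open>ay\<close>
  are congruent gives a nontrivial congruence containing \<open>R\<close>.\<close>

lemma (in B1_algebra) MaxSpec_subset_Spec: "MaxSpec A \<subseteq> Spec A"
proof
  fix R assume R: "R \<in> MaxSpec A"
  then have cR: "B1_congruence A R" and nt: "R \<in> nontrivial_congruences A"
    by (auto simp: MaxSpec_def nontrivial_congruences_def)
  from cR have eq: "equiv (carrier A) R" by (simp add: B1_congruence_def)
  have refl: "(x, x) \<in> R" if "x \<in> carrier A" for x
    using eq that by (auto simp: equiv_def refl_on_def)
  have sub: "x \<in> carrier A \<and> y \<in> carrier A" if "(x, y) \<in> R" for x y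
    using eq that by (auto simp: equiv_def)
  have sym: "(y, x) \<in> R" if "(x, y) \<in> R" for x y
    using eq that by (auto simp: equiv_def sym_def)
  have trans: "(x, z) \<in> R" if "(x, y) \<in> R" "(y, z) \<in> R" for x y z
    using eq that by (meson equiv_def transD)
  have add: "(x \<oplus> y, x' \<oplus> y') \<in> R" if "(x, x') \<in> R" "(y, y') \<in> R" for x x' y y'
    using cR that by (simp add: B1_congruence_def)
  have mult: "(x \<otimes> y, x' \<otimes> y') \<in> R" if "(x, x') \<in> R" "(y, y') \<in> R" for x x' y y'
    using cR that by (simp add: B1_congruence_def)
  have "(a, \<zero>) \<in> R \<or> (b, \<zero>) \<in> R"
    if a: "a \<in> carrier A" and b: "b \<in> carrier A" and ab: "(a \<otimes> b, \<zero>) \<in> R" for a b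
  proof (rule ccontr)
    assume H: "\<not> ((a, \<zero>) \<in> R \<or> (b, \<zero>) \<in> R)"
    define S where "S = {(x, y) \<in> carrier A \<times> carrier A. (a \<otimes> x, a \<otimes> y) \<in> R}"
    have "equiv (carrier A) S"
      by (auto simp: S_def equiv_def refl_on_def sym_def trans_def a intro: refl sym trans)
    moreover have "(x \<oplus> y, x' \<oplus> y') \<in> S" if "(x, x') \<in> S" "(y, y') \<in> S" for x x' y y'
      using that add[of "a \<otimes> x" "a \<otimes> x'" "a \<otimes> y" "a \<otimes> y'"] a
      by (auto simp: S_def r_distr)
    moreover have "(x \<otimes> y, x' \<otimes> y') \<in> S" if xy: "(x, x') \<in> S" "(y, y') \<in> S" for x x' y y'
    proof -
      have c: "x \<in> carrier A" "x' \<in> carrier A" "y \<in> carrier A" "y' \<in> carrier A"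
        using xy by (auto simp: S_def)
      have "((a \<otimes> x) \<otimes> y, (a \<otimes> x') \<otimes> y) \<in> R"
        using mult xy refl c by (auto simp: S_def)
      moreover have "((a \<otimes> y) \<otimes> x', (a \<otimes> y') \<otimes> x') \<in> R"
        using mult xy refl c by (auto simp: S_def)
      ultimately have "(a \<otimes> (x \<otimes> y), a \<otimes> (x' \<otimes> y')) \<in> R"
        using trans a c by (simp add: m_assoc m_comm[of y x'] m_comm[of y' x'])
      then show ?thesis using c by (simp add: S_def)
    qed
    ultimately have cS: "B1_congruence A S" by (simp add: B1_congruence_def)
    have "(\<one>, \<zero>) \<notin> S" using H a by (simp add: S_def)
    then have "S \<in> nontrivial_congruences A"
      using cS by (auto simp: nontrivial_congruences_def trivial_congruence_def)
    moreover have "R \<subseteq> S"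
      using sub mult refl a by (auto simp: S_def)
    ultimately have "S = R" using R by (simp add: MaxSpec_def)
    moreover have "(b, \<zero>) \<in> S" using ab a b by (simp add: S_def)
    ultimately show False using H by simp
  qed
  with nt show "R \<in> Spec A" by (simp add: Spec_def)
qed

end

theory Submission
  imports Defs
begin

text \<open>Membership in a saturated prime ideal \<open>P\<close> is a homomorphism onto the two-element
  \<open>B\<^sub>1\<close>-algebra: \<open>x + y \<in> P\<close> iff both summands lie in \<open>P\<close> (saturation and idempotence), and
  \<open>xy \<in> P\<close> iff one factor does. Hence \<open>\<alpha> P\<close> is a maximal congruence. Conversely every
  maximal congruence \<open>R\<close> lies below, hence equals, the congruence \<open>\<alpha> P\<close> of its zero class
  \<open>P\<close>. Since preimages under \<open>\<phi>\<close> commute with \<open>\<alpha>\<close>, pulling back preserves maximality.\<close>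

lemma B1_congruenceD:
  assumes "B1_congruence A R"
  shows "x \<in> carrier A \<Longrightarrow> (x, x) \<in> R"
    and "(x, y) \<in> R \<Longrightarrow> x \<in> carrier A" and "(x, y) \<in> R \<Longrightarrow> y \<in> carrier A"
    and "(x, y) \<in> R \<Longrightarrow> (y, x) \<in> R"
    and "(x, y) \<in> R \<Longrightarrow> (y, z) \<in> R \<Longrightarrow> (x, z) \<in> R"
    and "(x, x') \<in> R \<Longrightarrow> (y, y') \<in> R \<Longrightarrow> (x \<oplus>\<^bsub>A\<^esub> y, x' \<oplus>\<^bsub>A\<^esub> y') \<in> R"
    and "(x, x') \<in> R \<Longrightarrow> (y, y') \<in> R \<Longrightarrow> (x \<otimes>\<^bsub>A\<^esub> y, x' \<otimes>\<^bsub>A\<^esub> y') \<in> R"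
proof -
  have eq: "equiv (carrier A) R" using assms by (simp add: B1_congruence_def)
  show "x \<in> carrier A \<Longrightarrow> (x, x) \<in> R" using eq by (auto simp: equiv_def refl_on_def)
  show "(x, y) \<in> R \<Longrightarrow> x \<in> carrier A" "(x, y) \<in> R \<Longrightarrow> y \<in> carrier A"
    using eq by (auto simp: equiv_def)
  show "(x, y) \<in> R \<Longrightarrow> (y, x) \<in> R" using eq by (auto simp: equiv_def sym_def)
  show "(x, y) \<in> R \<Longrightarrow> (y, z) \<in> R \<Longrightarrow> (x, z) \<in> R" using eq by (meson equiv_def transD)
qed (use assms in \<open>simp_all add: B1_congruence_def\<close>)

lemma \<alpha>_mem_iff:
  "(x, y) \<in> \<alpha> A P \<longleftrightarrow> x \<in> carrier A \<and> y \<in> carrier A \<and> (x \<in> P \<longleftrightarrow> y \<in> P)"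
  by (auto simp: \<alpha>_def)

text \<open>Commutativity of the square: on either side \<open>a\<close> and \<open>a'\<close> are
  related exactly when \<open>P\<close> contains both or neither of \<open>\<phi> a\<close> and
  \<open>\<phi> a'\<close>.\<close>

lemma pullback_\<alpha>:
  assumes "\<phi> \<in> carrier A \<rightarrow> carrier C"
  shows "pullback_congruence A \<phi> (\<alpha> C P) = \<alpha> A (preimage_ideal A \<phi> P)"
  using assms by (auto simp: pullback_congruence_def preimage_ideal_def \<alpha>_def)

context B1_algebra
begin

lemma add_idem: "x \<in> carrier A \<Longrightarrow> x \<oplus> x = x"
  using l_distr[of \<one> \<one> x] by (simp add: one_add_one)

text \<open>Multiplying 1 ~ 0 by \<open>z\<close> gives \<open>z\<close> ~ 0, so all elements are
  equivalent. Nontriviality thus becomes a condition on the single pair (1, 0).\<close>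

lemma nontrivial_congruence_iff:
  assumes "B1_congruence A R"
  shows "R \<in> nontrivial_congruences A \<longleftrightarrow> (\<one>, \<zero>) \<notin> R"
proof -
  note R = B1_congruenceD[OF assms]
  have "R = trivial_congruence A" if one: "(\<one>, \<zero>) \<in> R"
  proof
    have "(z, \<zero>) \<in> R" if "z \<in> carrier A" for z
      using R(7)[OF R(1)[OF that] one] that by simp
    then show "trivial_congruence A \<subseteq> R"
      using R(4,5) unfolding trivial_congruence_def by blast
    show "R \<subseteq> trivial_congruence A"
      using assms by (auto simp: B1_congruence_def equiv_def trivial_congruence_def)
  qed
  moreover have "R \<noteq> trivial_congruence A" if "(\<one>, \<zero>) \<notin> R"
    using that by (auto simp: trivial_congruence_def)
  ultimately have "R = trivial_congruence A \<longleftrightarrow> (\<one>, \<zero>) \<in> R" by blast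
  with assms show ?thesis unfolding nontrivial_congruences_def by blast
qed

lemma B1_ideal_zero_class:
  assumes "B1_congruence A R"
  shows "B1_ideal A (zero_class A R)"
proof -
  note R = B1_congruenceD[OF assms]
  have "(x \<oplus> y, \<zero>) \<in> R" if "(x, \<zero>) \<in> R" "(y, \<zero>) \<in> R" for x y
    using R(6)[OF that] by simp
  moreover have "(a \<otimes> x, \<zero>) \<in> R" if "a \<in> carrier A" "(x, \<zero>) \<in> R" for a x
    using R(7)[OF R(1)[OF that(1)] that(2)] that(1) by simp
  ultimately show ?thesis using R(1) by (auto simp: B1_ideal_def zero_class_def)
qed

text \<open>Primality of \<open>R\<close> is literally primality of its zero class, \<open>R\<close>
  itself witnesses saturation, and 1 lies outside the class because \<open>R\<close> is
  nontrivial.\<close>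

lemma zero_class_Pr_s:
  assumes "R \<in> Spec A"
  shows "zero_class A R \<in> Pr_s A"
proof -
  have R: "B1_congruence A R" and nt: "R \<in> nontrivial_congruences A"
    using assms by (auto simp: Spec_def nontrivial_congruences_def)
  have "\<one> \<notin> zero_class A R"
    using nontrivial_congruence_iff[OF R] nt by (simp add: zero_class_def)
  then have "zero_class A R \<noteq> carrier A" by auto
  then show ?thesis
    using assms B1_ideal_zero_class[OF R] R
    by (auto simp: Pr_s_def B1_prime_ideal_def saturated_ideal_def Spec_def zero_class_def)
qed

text \<open>Suppose u + v ~ 0 in a congruence whose zero class is \<open>P\<close>. Adding u and
  using u + u = u yields u + v = u + (u + v) ~ u + 0 = u, so u ~ 0.\<close>

lemma saturated_ideal_add_iff:
  assumes "saturated_ideal A P" "x \<in> carrier A" "y \<in> carrier A"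
  shows "x \<oplus> y \<in> P \<longleftrightarrow> x \<in> P \<and> y \<in> P"
proof -
  obtain R where cR: "B1_congruence A R" and P: "P = zero_class A R"
    using assms(1) by (auto simp: saturated_ideal_def)
  note R = B1_congruenceD[OF cR]
  have absorb: "(u, \<zero>) \<in> R" if "(u \<oplus> v, \<zero>) \<in> R" "u \<in> carrier A" "v \<in> carrier A" for u v
  proof -
    have "(u \<oplus> (u \<oplus> v), u \<oplus> \<zero>) \<in> R" using R(1,6) that by blast
    moreover have "u \<oplus> (u \<oplus> v) = u \<oplus> v"
      using that add_idem by (simp flip: add.m_assoc)
    ultimately show ?thesis using that R(4)[of "u \<oplus> v" u] R(5)[of u "u \<oplus> v" \<zero>] by simp
  qed
  have "x \<oplus> y \<in> P \<Longrightarrow> x \<in> P \<and> y \<in> P"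
    using absorb[of x y] absorb[of y x] assms(2,3) by (auto simp: P zero_class_def a_comm)
  moreover have "x \<in> P \<Longrightarrow> y \<in> P \<Longrightarrow> x \<oplus> y \<in> P"
    using assms(1) by (auto simp: saturated_ideal_def B1_ideal_def)
  ultimately show ?thesis by blast
qed

lemma prime_ideal_mult_iff:
  assumes "B1_prime_ideal A P" "x \<in> carrier A" "y \<in> carrier A"
  shows "x \<otimes> y \<in> P \<longleftrightarrow> x \<in> P \<or> y \<in> P"
proof
  assume "x \<otimes> y \<in> P"
  then show "x \<in> P \<or> y \<in> P" using assms by (simp add: B1_prime_ideal_def)
next
  \<comment> \<open>The definition of an ideal absorbs factors from the left; commutativity supplies
    the case where the left factor lies in \<open>P\<close>.\<close>
  have "a \<otimes> b \<in> P" if "a \<in> carrier A" "b \<in> P" for a b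
    using assms(1) that by (simp add: B1_prime_ideal_def B1_ideal_def)
  then show "x \<in> P \<or> y \<in> P \<Longrightarrow> x \<otimes> y \<in> P"
    using assms(2,3) m_comm[OF assms(2,3)] by metis
qed

text \<open>The two preceding equivalences say that membership of a sum or product in
  \<open>P\<close> depends only on membership of its terms, which is compatibility of
  \<open>\<alpha> A P\<close>. With just two classes, any strictly larger congruence must merge
  them.\<close>

lemma \<alpha>_MaxSpec:
  assumes "P \<in> Pr_s A"
  shows "\<alpha> A P \<in> MaxSpec A"
proof -
  have prime: "B1_prime_ideal A P" and sat: "saturated_ideal A P"
    using assms by (auto simp: Pr_s_def)
  have sub: "P \<subseteq> carrier A" and zero: "\<zero> \<in> P"
    using sat by (auto simp: saturated_ideal_def B1_ideal_def)
  have one: "\<one> \<notin> P"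
  proof
    assume "\<one> \<in> P"
    then have "x \<in> P" if "x \<in> carrier A" for x
      using prime_ideal_mult_iff[OF prime that one_closed] that by simp
    then show False using prime sub by (auto simp: B1_prime_ideal_def)
  qed
  have "equiv (carrier A) (\<alpha> A P)"
    by (auto simp: equiv_def refl_on_def sym_def trans_def \<alpha>_mem_iff)
  then have cong: "B1_congruence A (\<alpha> A P)"
    using saturated_ideal_add_iff[OF sat] prime_ideal_mult_iff[OF prime]
    by (auto simp: B1_congruence_def \<alpha>_mem_iff)
  moreover have "S = \<alpha> A P" if S: "S \<in> nontrivial_congruences A" and le: "\<alpha> A P \<subseteq> S" for S
  proof -
    have cS: "B1_congruence A S" using S by (simp add: nontrivial_congruences_def)
    note S' = B1_congruenceD[OF cS]
    have no: "(\<one>, \<zero>) \<notin> S" using nontrivial_congruence_iff[OF cS] S by simp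
    \<comment> \<open>A pair in \<open>S\<close> that crosses the boundary of \<open>P\<close> gives
      the chain 1 ~ y ~ x ~ 0. The outer links come from \<open>\<alpha> A P \<subseteq> S\<close>:
      1 and \<open>y\<close> lie outside \<open>P\<close>, while \<open>x\<close> and 0 lie
      inside.\<close>
    have sep: False if xy: "(x, y) \<in> S" and "x \<in> P" "y \<notin> P" for x y
    proof -
      have "(x, \<zero>) \<in> S" "(\<one>, y) \<in> S"
        using le that sub zero one S'(3)[OF xy] by (auto simp: \<alpha>_mem_iff subset_iff)
      then show False using no S'(4,5) xy by blast
    qed
    have "S \<subseteq> \<alpha> A P"
    proof (rule subrelI)
      fix x y assume xy: "(x, y) \<in> S"
      then show "(x, y) \<in> \<alpha> A P"
        using sep[OF xy] sep[OF S'(4)[OF xy]] S'(2,3)[OF xy] by (auto simp: \<alpha>_mem_iff)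
    qed
    then show ?thesis using le by blast
  qed
  ultimately show ?thesis
    using nontrivial_congruence_iff[OF cong] zero one by (auto simp: MaxSpec_def \<alpha>_mem_iff)
qed

text \<open>Equivalent elements are both or neither equivalent to 0, so \<open>R\<close> is
  contained in the right-hand side. Since \<open>R\<close> is prime, the right-hand side is a
  nontrivial congruence, and maximality of \<open>R\<close> forces equality.\<close>

lemma MaxSpec_eq_\<alpha>:
  assumes "R \<in> MaxSpec A"
  shows "R = \<alpha> A (zero_class A R)"
proof -
  have R: "B1_congruence A R"
    using assms by (simp add: MaxSpec_def nontrivial_congruences_def)
  have "\<alpha> A (zero_class A R) \<in> MaxSpec A"
    using assms MaxSpec_subset_Spec by (intro \<alpha>_MaxSpec zero_class_Pr_s) auto
  moreover have "R \<subseteq> \<alpha> A (zero_class A R)"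
    proof (rule subrelI)
    fix x y assume xy: "(x, y) \<in> R"
    then have "(x, \<zero>) \<in> R \<longleftrightarrow> (y, \<zero>) \<in> R" using B1_congruenceD(4,5)[OF R] by blast
    then show "(x, y) \<in> \<alpha> A (zero_class A R)"
      using B1_congruenceD(2,3)[OF R xy] by (simp add: \<alpha>_mem_iff zero_class_def)
  qed
  ultimately show ?thesis using assms by (auto simp: MaxSpec_def)
qed

end

text \<open>Since \<phi> preserves 0 and 1, both nontriviality, read off from the pair (1, 0), and
  primality transfer from \<open>R\<close>.\<close>

lemma pullback_Spec:
  assumes "B1_algebra A" "B1_algebra C" and hom: "\<phi> \<in> B1_hom A C" and "R \<in> Spec C"
  shows "pullback_congruence A \<phi> R \<in> Spec A"
proof -
  interpret A: B1_algebra A by fact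
  interpret C: B1_algebra C by fact
  have \<phi>: "\<phi> \<in> ring_hom A C" and zero: "\<phi> \<zero>\<^bsub>A\<^esub> = \<zero>\<^bsub>C\<^esub>"
    using hom by (auto simp: B1_hom_def)
  note h = ring_hom_closed[OF \<phi>] ring_hom_add[OF \<phi>] ring_hom_mult[OF \<phi>] ring_hom_one[OF \<phi>] zero
  have cR: "B1_congruence C R" and nt: "R \<in> nontrivial_congruences C"
    using \<open>R \<in> Spec C\<close> by (auto simp: Spec_def nontrivial_congruences_def)
  note R = B1_congruenceD[OF cR]
  let ?S = "pullback_congruence A \<phi> R"
  have "equiv (carrier A) ?S"
    by (auto simp: equiv_def refl_on_def sym_def trans_def pullback_congruence_def h
        intro: R(1,4,5))
  then have cS: "B1_congruence A ?S"
    using R(6,7) by (auto simp: B1_congruence_def pullback_congruence_def h)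
  have "(\<one>\<^bsub>A\<^esub>, \<zero>\<^bsub>A\<^esub>) \<notin> ?S"
    using C.nontrivial_congruence_iff[OF cR] nt by (simp add: pullback_congruence_def h)
  then have "?S \<in> nontrivial_congruences A"
    using A.nontrivial_congruence_iff[OF cS] by simp
  then show ?thesis
    using \<open>R \<in> Spec C\<close> by (auto simp: Spec_def pullback_congruence_def h)
qed

text \<open>Saturation needs a congruence on \<open>A\<close>: pulling back the prime congruence
  \<open>\<alpha> C P\<close> provides one whose zero class is the preimage.\<close>

lemma preimage_Pr_s:
  assumes "B1_algebra A" "B1_algebra C" and hom: "\<phi> \<in> B1_hom A C" and P: "P \<in> Pr_s C"
  shows "preimage_ideal A \<phi> P \<in> Pr_s A"
proof -
  interpret A: B1_algebra A by fact
  interpret C: B1_algebra C by fact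
  have \<phi>: "\<phi> \<in> carrier A \<rightarrow> carrier C" and zero: "\<phi> \<zero>\<^bsub>A\<^esub> = \<zero>\<^bsub>C\<^esub>"
    using hom by (auto simp: B1_hom_def ring_hom_def)
  \<comment> \<open>As 0 lies in \<open>P\<close>, being related to 0 under
    \<open>\<alpha> C P\<close> amounts to membership in \<open>P\<close>.\<close>
  have "\<zero>\<^bsub>C\<^esub> \<in> P" using P by (auto simp: Pr_s_def saturated_ideal_def B1_ideal_def)
  then have "preimage_ideal A \<phi> P = zero_class A (pullback_congruence A \<phi> (\<alpha> C P))"
    unfolding pullback_\<alpha>[OF \<phi>] using zero
    by (auto simp: zero_class_def preimage_ideal_def \<alpha>_mem_iff)
  moreover have "\<alpha> C P \<in> Spec C"
    using C.\<alpha>_MaxSpec[OF P] C.MaxSpec_subset_Spec by blast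
  ultimately show ?thesis
    using A.zero_class_Pr_s pullback_Spec[OF assms(1-3)] by simp
qed

text \<open>Maximality is not compared across \<phi> directly. Instead \<open>R\<close> is written
  as \<alpha> of its zero class, so its pullback is \<alpha> of a saturated prime ideal of
  \<open>A\<close>.\<close>

lemma pullback_MaxSpec:
  assumes "B1_algebra A" "B1_algebra C" and hom: "\<phi> \<in> B1_hom A C" and R: "R \<in> MaxSpec C"
  shows "pullback_congruence A \<phi> R \<in> MaxSpec A"
proof -
  interpret A: B1_algebra A by fact
  interpret C: B1_algebra C by fact
  have \<phi>: "\<phi> \<in> carrier A \<rightarrow> carrier C" using hom by (auto simp: B1_hom_def ring_hom_def)
  have "zero_class C R \<in> Pr_s C" using R C.MaxSpec_subset_Spec C.zero_class_Pr_s by blast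
  then have "\<alpha> A (preimage_ideal A \<phi> (zero_class C R)) \<in> MaxSpec A"
    using A.\<alpha>_MaxSpec preimage_Pr_s[OF assms(1-3)] by blast
  then show ?thesis
    by (subst C.MaxSpec_eq_\<alpha>[OF R]) (simp add: pullback_\<alpha>[OF \<phi>])
qed

theorem theorem4p2:
  fixes A :: "('a, 'm) ring_scheme" and C :: "('c, 'n) ring_scheme" and \<phi> :: "'a \<Rightarrow> 'c"
  assumes "B1_algebra A" and "B1_algebra C" and "\<phi> \<in> B1_hom A C"
  shows "pullback_congruence A \<phi> \<in> Spec C \<rightarrow> Spec A
    \<and> pullback_congruence A \<phi> \<in> MaxSpec C \<rightarrow> MaxSpec A
    \<and> preimage_ideal A \<phi> \<in> Pr_s C \<rightarrow> Pr_s A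
    \<and> \<alpha> C \<in> Pr_s C \<rightarrow> MaxSpec C
    \<and> \<alpha> A \<in> Pr_s A \<rightarrow> MaxSpec A
    \<and> (\<forall>P\<in>Pr_s C. pullback_congruence A \<phi> (\<alpha> C P) = \<alpha> A (preimage_ideal A \<phi> P))"
proof -
  have "\<phi> \<in> carrier A \<rightarrow> carrier C" using assms(3) by (auto simp: B1_hom_def ring_hom_def)
  then show ?thesis
    using pullback_Spec[OF assms] pullback_MaxSpec[OF assms] preimage_Pr_s[OF assms]
      B1_algebra.\<alpha>_MaxSpec[OF assms(1)] B1_algebra.\<alpha>_MaxSpec[OF assms(2)]
    by (simp add: Pi_iff pullback_\<alpha>)
qed

end
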